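(* Let $(V,E,\mathbf 1_r)$ be a root-reward tree and let $v\in O$. Write $\mathrm{Stake}(\lambda,v)=\mathrm{Stake}(1,\lambda,v)$. Then $$\lim_{\lambda\searrow0}\mathrm{Stake}(\lambda,v)=d_{\rm in}(v)^{-1},\qquad \mathrm{Stake}(1,v)=d_{\rm out}(v)^{-1}d_{\rm in}(v)^{-1},$$ (the latter being the case $\lambda=1$) and $$\lim_{\lambda\nearrow\infty}\lambda^{d_{\rm out}(v)-d_{\rm out}^{\min}(v)}\cdot\mathrm{Stake}(\lambda,v)=\left(|J|\cdot d_{\rm out}^{\min}(v)\right)^{-1},$$ where $d_{\rm out}^{\min}(v)$ is the minimum of $d_{\rm out}(w)$ as $w$ ranges over the vertices of the geodesic path $[r,v]$, and $J$ is the set of vertices $w$ on $[r,v]$ such that $d_{\rm out}(w)=d_{\rm out}^{\min}(v)$.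
   Context: A root-reward tree $(V,E,\mathbf 1_r)$ consists of a finite rooted tree $(V,E)$ whose root $r$ is a leaf; $B$ is the set of all leaves (including $r$), $B^*=B\setminus\{r\}$, $O=V\setminus B$ is non-empty, and $p=\mathbf 1_r:B\to\{0,1\}$. $u\sim v$ denotes adjacency and $d$ graph distance. $d_{\rm in}(v)=d(r,v)$, and $d_{\rm out}(v)$ is the minimum length of a path from $v$ to $B^*$ each of whose edges leads away from $r$. For $\lambda\in(0,\infty)$, $h(\lambda,\cdot):V\to[0,\infty)$ is the unique solution of: $h(\lambda,v)=p(v)$ for $v\in B$, and $h(\lambda,v)=\frac{\lambda}{\lambda+1}\max_{u\sim v}h(\lambda,u)+\frac1{\lambda+1}\min_{u\sim v}h(\lambda,u)$ for $v\in O$; it is differentiable in $\lambda$. For $v\in O$, $\Delta(\lambda,v)=\max_{w\sim v}h(\lambda,w)-\min_{w\sim v}h(\lambda,w)$ and $\mathrm{Stake}(\epsilon,\lambda,v)=\dfrac{\epsilon\,\Delta(\lambda,v)}{(\lambda+1)^2\frac{\partial}{\partial\lambda}h(\lambda,v)}$. *)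

theory Defs
  imports "HOL-Analysis.Analysis" "Graph_Theory.Digraph_Component"
begin

text \<open>
  A finite simple graph is a symmetric digraph (locale \<^locale>\<open>graph\<close>); its undirected edges are
  pairs of opposite arcs.
\<close>

definition nbrs :: "('a, 'b) pre_digraph \<Rightarrow> 'a \<Rightarrow> 'a set" where
  "nbrs G v = {u. v \<rightarrow>\<^bsub>G\<^esub> u}"

definition leaves :: "('a, 'b) pre_digraph \<Rightarrow> 'a set" where
  "leaves G = {v \<in> verts G. card (nbrs G v) = 1}"

definition inner_verts :: "('a, 'b) pre_digraph \<Rightarrow> 'a set" where
  "inner_verts G = verts G - leaves G"

text \<open>
  The predicate \<^const>\<open>tree\<close> cannot be used here: with two opposite arcs per edge, a walk
  \<open>a, b, a\<close> counts as a \<open>cycle\<close>. In a \<^locale>\<open>graph\<close> the cycles of the undirected graph are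
  exactly those with at least three arcs.
\<close>

locale root_reward_tree = graph G for G :: "('a, 'b) pre_digraph" +
  fixes r :: 'a
  assumes connected: "Digraph_Component.connected G"
    and acyclic: "\<nexists>p. cycle p \<and> 3 \<le> length p"
    and root_leaf: "r \<in> leaves G"
    and inner_verts_nonempty: "inner_verts G \<noteq> {}"

definition gdist :: "('a, 'b) pre_digraph \<Rightarrow> 'a \<Rightarrow> 'a \<Rightarrow> nat" where
  "gdist G u v = (LEAST n. \<exists>p. pre_digraph.awalk G u p v \<and> length p = n)"

definition geodesic_verts :: "('a, 'b) pre_digraph \<Rightarrow> 'a \<Rightarrow> 'a \<Rightarrow> 'a set" where
  "geodesic_verts G u v =
    {w. \<exists>p. pre_digraph.awalk G u p v \<and> length p = gdist G u v \<and>
            w \<in> set (pre_digraph.awalk_verts G u p)}"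

definition d_in :: "('a, 'b) pre_digraph \<Rightarrow> 'a \<Rightarrow> 'a \<Rightarrow> nat" where
  "d_in G r v = gdist G r v"

definition d_out :: "('a, 'b) pre_digraph \<Rightarrow> 'a \<Rightarrow> 'a \<Rightarrow> nat" where
  "d_out G r v =
    (LEAST n. \<exists>p. \<exists>b \<in> leaves G - {r}. pre_digraph.awalk G v p b \<and> length p = n \<and>
       (\<forall>e \<in> set p. gdist G r (tail G e) < gdist G r (head G e)))"

definition d_out_min :: "('a, 'b) pre_digraph \<Rightarrow> 'a \<Rightarrow> 'a \<Rightarrow> nat" where
  "d_out_min G r v = Min (d_out G r ` geodesic_verts G r v)"

definition J_set :: "('a, 'b) pre_digraph \<Rightarrow> 'a \<Rightarrow> 'a \<Rightarrow> 'a set" where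
  "J_set G r v = {w \<in> geodesic_verts G r v. d_out G r w = d_out_min G r v}"

text \<open>
  Functions on the vertex set are taken extensional, so that a unique solution on the vertices
  is a unique HOL function.
\<close>

definition is_biased_infinity_harmonic ::
  "('a, 'b) pre_digraph \<Rightarrow> 'a \<Rightarrow> real \<Rightarrow> ('a \<Rightarrow> real) \<Rightarrow> bool" where
  "is_biased_infinity_harmonic G r l f \<longleftrightarrow>
     f \<in> verts G \<rightarrow>\<^sub>E {0..} \<and>
     (\<forall>v \<in> leaves G. f v = indicat_real {r} v) \<and>
     (\<forall>v \<in> inner_verts G.
        f v = l / (l + 1) * Max (f ` nbrs G v) + 1 / (l + 1) * Min (f ` nbrs G v))"

definition h :: "('a, 'b) pre_digraph \<Rightarrow> 'a \<Rightarrow> real \<Rightarrow> 'a \<Rightarrow> real" where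
  "h G r l = (THE f. is_biased_infinity_harmonic G r l f)"

definition Delta :: "('a, 'b) pre_digraph \<Rightarrow> 'a \<Rightarrow> real \<Rightarrow> 'a \<Rightarrow> real" where
  "Delta G r l v = Max (h G r l ` nbrs G v) - Min (h G r l ` nbrs G v)"

definition Stake :: "('a, 'b) pre_digraph \<Rightarrow> 'a \<Rightarrow> real \<Rightarrow> real \<Rightarrow> 'a \<Rightarrow> real" where
  "Stake G r \<epsilon> l v = \<epsilon> * Delta G r l v / ((l + 1)\<^sup>2 * deriv (\<lambda>x. h G r x v) l)"

end

theory Submission
  imports Defs
begin

text \<open>
  The point is that \<open>h\<close> has an explicit product form. In a root-reward tree the value decreases away
  from the root, so at an inner vertex \<open>v\<close> the maximum is attained at the parent and the minimum
  at a child. Going up from the leaves one finds that \<open>h(l, v) = a(l) * h(l, parent of v)\<close>, where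
  the factor depends on \<open>v\<close> only through \<open>n = d_out v\<close>. It is
  \<open>a_n(l) = 1 - 1 / (1 + l + ... + l ^ n)\<close>, which satisfies \<open>a_0 = 0\<close> and the recursion
  \<open>a_(n+1) = l / (l + 1) + 1 / (l + 1) * a_n * a_(n+1)\<close> (\<open>decay_fixed_point\<close>); since \<open>a_n\<close>
  increases with \<open>n\<close>, the child of \<open>v\<close> with the lowest value of \<open>h\<close> is one with least \<open>d_out\<close>. Hence \<open>h(l, v)\<close>
  is the product of these factors over the geodesic from the root to \<open>v\<close>
  (\<open>profile_harmonic\<close>). A comparison principle shows that it is the only solution
  (\<open>harmonic_unique\<close>).

  With \<open>S_n = 1 + l + ... + l ^ n\<close> and \<open>D = d_out v\<close>, the product form gives
  \<open>\<Delta> = h * (l + 1) / (l * S_(D-1))\<close>, and logarithmic differentiation gives \<open>h' = h / l * \<Sum>\<close>, where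
  \<open>\<Sum>\<close> adds the elasticities \<open>e_n = l * a_n' / a_n = S_n' / (S_(n-1) * S_n)\<close> with \<open>n = d_out w\<close> for
  all \<open>w\<close> on the geodesic other than the root. So the stake equals
  \<open>1 / ((l + 1) * S_(D-1) * \<Sum>)\<close> (\<open>Stake_eq\<close>). The three claims are read off from the behaviour of
  \<open>e_n\<close> for \<open>n \<ge> 1\<close>: it tends to \<open>1\<close> as \<open>l\<close> tends to \<open>0\<close>, it equals \<open>1 / 2\<close> at \<open>l = 1\<close>, and it is
  asymptotic to \<open>n / l ^ n\<close> for large \<open>l\<close>, so that there the sum is dominated by the vertices in
  \<open>J\<close>. The number of summands is \<open>d_in v\<close>.
\<close>

section \<open>Geometric sums and their elasticities\<close>

definition geom_sum :: "nat \<Rightarrow> real \<Rightarrow> real" where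
  "geom_sum n x = (\<Sum>i\<le>n. x ^ i)"

definition geom_sum_deriv :: "nat \<Rightarrow> real \<Rightarrow> real" where
  "geom_sum_deriv n x = (\<Sum>i\<le>n. real i * x ^ (i - 1))"

text \<open>
  If \<open>n\<close> is the distance from a vertex to the nearest unrewarded leaf below it, then
  \<open>decay n l\<close> is the factor by which the value \<open>h(l, \<cdot>)\<close> drops from the parent of the vertex to
  the vertex. Writing it as \<open>1 - 1 / geom_sum n l\<close> makes monotonicity in \<open>n\<close> and the derivative in
  \<open>l\<close> immediate.
\<close>

definition decay :: "nat \<Rightarrow> real \<Rightarrow> real" where
  "decay n x = 1 - 1 / geom_sum n x"

text \<open>
  For \<open>n > 0\<close> and \<open>x > 0\<close> this is the quotient \<open>x * a'(x) / a(x)\<close> for \<open>a = decay n\<close>.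
\<close>

definition elasticity :: "nat \<Rightarrow> real \<Rightarrow> real" where
  "elasticity n x = geom_sum_deriv n x / (geom_sum (n - 1) x * geom_sum n x)"

lemma geom_sum_0 [simp]: "geom_sum 0 x = 1"
  by (simp add: geom_sum_def)

lemma geom_sum_Suc: "geom_sum (Suc n) x = 1 + x * geom_sum n x"
  unfolding geom_sum_def by (subst sum.atMost_Suc_shift) (simp add: sum_distrib_left)

lemma geom_sum_ge_1: "0 \<le> x \<Longrightarrow> 1 \<le> geom_sum n x"
  by (induction n) (auto simp: geom_sum_Suc)

lemma geom_sum_pos: "0 \<le> x \<Longrightarrow> 0 < geom_sum n x"
  using geom_sum_ge_1[of x n] by simp

lemma geom_sum_mono: "0 \<le> x \<Longrightarrow> m \<le> n \<Longrightarrow> geom_sum m x \<le> geom_sum n x"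
  unfolding geom_sum_def by (intro sum_mono2) auto

lemma DERIV_geom_sum: "(geom_sum n has_real_derivative geom_sum_deriv n x) (at x)"
  unfolding geom_sum_def[abs_def] geom_sum_deriv_def by (auto intro!: derivative_eq_intros sum.cong)

lemma decay_0 [simp]: "decay 0 x = 0"
  by (simp add: decay_def)

lemma decay_Suc: "0 \<le> x \<Longrightarrow> decay (Suc n) x = x * geom_sum n x / geom_sum (Suc n) x"
  using geom_sum_pos[of x "Suc n"] by (simp add: decay_def field_simps geom_sum_Suc)

lemma decay_nonneg: "0 \<le> x \<Longrightarrow> 0 \<le> decay n x"
  using geom_sum_ge_1[of x n] by (simp add: decay_def)

lemma decay_le_1: "0 \<le> x \<Longrightarrow> decay n x \<le> 1"
  using geom_sum_pos[of x n] by (simp add: decay_def)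

lemma decay_pos: "0 < x \<Longrightarrow> 0 < n \<Longrightarrow> 0 < decay n x"
  using geom_sum_pos[of x n] geom_sum_pos[of x "n - 1"] decay_Suc[of x "n - 1"] by simp

lemma decay_mono: "0 \<le> x \<Longrightarrow> m \<le> n \<Longrightarrow> decay m x \<le> decay n x"
  using geom_sum_mono[of x m n] geom_sum_pos[of x m] by (simp add: decay_def frac_le)

text \<open>
  The averaging equation at a vertex, divided by the value at its parent. With value \<open>1\<close> at the
  parent, the vertex has value \<open>decay (Suc n) x\<close> and its lowest-valued child has value
  \<open>decay n x * decay (Suc n) x\<close>.
\<close>

lemma decay_fixed_point:
  assumes "0 < x"
  shows "decay (Suc n) x = x / (x + 1) + 1 / (x + 1) * (decay n x * decay (Suc n) x)"
proof -
  have g: "0 < geom_sum n x" "0 < geom_sum (Suc n) x" using geom_sum_pos assms by auto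
  have "(x + 1 - decay n x) * geom_sum n x = geom_sum (Suc n) x"
    using g by (simp add: decay_def geom_sum_Suc algebra_simps)
  then have "decay (Suc n) x * (x + 1 - decay n x) = x"
    using g assms by (simp add: decay_Suc field_simps)
  then have "decay (Suc n) x * (x + 1) = x + decay n x * decay (Suc n) x"
    by (simp add: algebra_simps)
  then have "decay (Suc n) x = (x + decay n x * decay (Suc n) x) / (x + 1)"
    using assms by (simp add: eq_divide_eq)
  then show ?thesis by (simp add: add_divide_distrib)
qed

text \<open>
  In the same normalisation the left-hand side is the difference of the extreme values around the
  vertex, here expressed as a multiple of the value at the vertex itself.
\<close>

lemma decay_spread:
  assumes "0 < x"
  shows "1 - decay n x * decay (Suc n) x = decay (Suc n) x * (x + 1) / (x * geom_sum n x)"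
proof -
  have g: "0 < geom_sum n x" "0 < geom_sum (Suc n) x" using geom_sum_pos assms by auto
  have "1 - decay n x * decay (Suc n) x = (x + 1) / geom_sum (Suc n) x"
  proof -
    have "geom_sum (Suc n) x - x * (geom_sum n x - 1) = x + 1" by (simp add: geom_sum_Suc algebra_simps)
    moreover have "decay n x * decay (Suc n) x = x * (geom_sum n x - 1) / geom_sum (Suc n) x"
      using g assms by (simp add: decay_Suc decay_def[of n] field_simps)
    ultimately show ?thesis using g by (simp add: field_simps)
  qed
  then show ?thesis using g assms by (simp add: decay_Suc)
qed

lemma DERIV_decay:
  assumes "0 < x" "0 < n"
  shows "(decay n has_real_derivative decay n x * (elasticity n x / x)) (at x)"
proof -
  obtain m where n: "n = Suc m" using assms(2) gr0_implies_Suc by blast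
  have g: "0 < geom_sum m x" "0 < geom_sum n x" using geom_sum_pos assms by auto
  have "(decay n has_real_derivative geom_sum_deriv n x / (geom_sum n x)\<^sup>2) (at x)"
    unfolding decay_def[abs_def]
    using g by (auto intro!: derivative_eq_intros DERIV_geom_sum simp: power2_eq_square)
  moreover have "geom_sum_deriv n x / (geom_sum n x)\<^sup>2 = decay n x * (elasticity n x / x)"
    using g assms(1) unfolding n elasticity_def
    by (simp add: decay_Suc power2_eq_square)
  ultimately show ?thesis by simp
qed

lemma DERIV_prod_log:
  fixes f :: "'i \<Rightarrow> real \<Rightarrow> real"
  assumes "finite I" "\<And>i. i \<in> I \<Longrightarrow> (f i has_real_derivative f i x * e i) (at x)"
  shows "((\<lambda>x. \<Prod>i\<in>I. f i x) has_real_derivative (\<Prod>i\<in>I. f i x) * (\<Sum>i\<in>I. e i)) (at x)"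
  using assms
proof (induction rule: finite_induct)
  case (insert i I)
  have "((\<lambda>x. f i x * (\<Prod>i\<in>I. f i x)) has_real_derivative
      f i x * e i * (\<Prod>i\<in>I. f i x) + (\<Prod>i\<in>I. f i x) * (\<Sum>i\<in>I. e i) * f i x) (at x)"
    using insert by (intro DERIV_mult) auto
  with insert show ?case by (simp add: algebra_simps)
qed simp

lemma geom_sum_at_1: "geom_sum n 1 = real n + 1"
  by (simp add: geom_sum_def)

lemma geom_sum_deriv_at_1: "geom_sum_deriv n 1 = real n * (real n + 1) / 2"
  unfolding geom_sum_deriv_def by (induction n) (auto simp: field_simps)

lemma elasticity_at_1: "0 < n \<Longrightarrow> elasticity n 1 = 1 / 2"
  by (simp add: elasticity_def geom_sum_at_1 geom_sum_deriv_at_1 of_nat_diff)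

lemma elasticity_tendsto_at_0:
  assumes "0 < n"
  shows "(elasticity n \<longlongrightarrow> 1) (at_right 0)"
proof -
  have "((\<lambda>x. geom_sum_deriv n x / (geom_sum (n - 1) x * geom_sum n x))
      \<longlongrightarrow> geom_sum_deriv n 0 / (geom_sum (n - 1) 0 * geom_sum n 0)) (at_right 0)"
    using geom_sum_pos[of 0] unfolding geom_sum_deriv_def geom_sum_def 
    by (intro tendsto_intros) (auto simp: less_le)
  moreover have "geom_sum k 0 = 1" for k by (cases k) (auto simp: geom_sum_Suc)
  moreover have "geom_sum_deriv n 0 = 1"
  proof -
    have "geom_sum_deriv n 0 = (\<Sum>i\<le>n. if i = 1 then 1 else 0)"
      unfolding geom_sum_deriv_def by (intro sum.cong) (auto simp: power_0_left)
    also have "\<dots> = 1" using assms by simp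
    finally show ?thesis .
  qed
  ultimately show ?thesis by (simp add: elasticity_def[abs_def])
qed

lemma power_quotient_at_top:
  assumes "i \<le> n"
  shows "((\<lambda>x::real. x ^ i / x ^ n) \<longlongrightarrow> of_bool (i = n)) at_top"
proof (cases "i = n")
  case True
  have "\<forall>\<^sub>F x::real in at_top. 1 = x ^ n / x ^ n"
    using eventually_gt_at_top[of 0] by eventually_elim auto
  then have "((\<lambda>x::real. x ^ n / x ^ n) \<longlongrightarrow> 1) at_top"
    using tendsto_const by (rule Lim_transform_eventually[rotated])
  with True show ?thesis by simp
next
  case False
  then have "0 < n - i" using assms by simp
  then have "filterlim (\<lambda>x::real. x ^ (n - i)) at_top at_top"
    by (rule filterlim_pow_at_top[OF _ filterlim_ident])
  then have "((\<lambda>x::real. inverse (x ^ (n - i))) \<longlongrightarrow> 0) at_top"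
    by (rule tendsto_inverse_0_at_top)
  moreover have "\<forall>\<^sub>F x::real in at_top. inverse (x ^ (n - i)) = x ^ i / x ^ n"
    using eventually_gt_at_top[of 0]
    by eventually_elim (use assms in \<open>simp add: power_diff field_simps\<close>)
  ultimately show ?thesis using False by (simp add: Lim_transform_eventually)
qed

lemma geom_sum_at_top: "((\<lambda>x. geom_sum n x / x ^ n) \<longlongrightarrow> 1) at_top"
proof -
  have "((\<lambda>x::real. \<Sum>i\<le>n. x ^ i / x ^ n) \<longlongrightarrow> (\<Sum>i\<le>n. of_bool (i = n))) at_top"
    by (intro tendsto_sum power_quotient_at_top) auto
  then show ?thesis by (simp add: geom_sum_def sum_divide_distrib of_bool_def)
qed

lemma geom_sum_deriv_at_top: "((\<lambda>x. geom_sum_deriv n x / x ^ (n - 1)) \<longlongrightarrow> real n) at_top"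
proof -
  have "((\<lambda>x::real. \<Sum>i\<le>n. real i * (x ^ (i - 1) / x ^ (n - 1)))
      \<longlongrightarrow> (\<Sum>i\<le>n. real i * of_bool (i - 1 = n - 1))) at_top"
    by (intro tendsto_intros power_quotient_at_top) auto
  moreover have "(\<Sum>i\<le>n. real i * of_bool (i - 1 = n - 1)) = (\<Sum>i\<le>n. if i = n then real n else 0)"
    by (intro sum.cong) auto
  ultimately show ?thesis by (simp add: geom_sum_deriv_def sum_divide_distrib)
qed

text \<open>
  As \<open>x\<close> grows, \<open>geom_sum n x\<close> behaves like \<open>x ^ n\<close> and its derivative like \<open>n * x ^ (n - 1)\<close>, so
  that \<open>elasticity n x\<close> behaves like \<open>n * x powi (- n)\<close>.
\<close>

lemma elasticity_at_top:
  assumes "0 < n"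
  shows "((\<lambda>x. x ^ n * elasticity n x) \<longlongrightarrow> real n) at_top"
proof -
  have "((\<lambda>x. (geom_sum_deriv n x / x ^ (n - 1)) /
        ((geom_sum (n - 1) x / x ^ (n - 1)) * (geom_sum n x / x ^ n)))
      \<longlongrightarrow> real n / (1 * 1)) at_top"
    by (intro tendsto_intros geom_sum_deriv_at_top geom_sum_at_top) auto
  moreover have "\<forall>\<^sub>F x in at_top. (geom_sum_deriv n x / x ^ (n - 1)) /
        ((geom_sum (n - 1) x / x ^ (n - 1)) * (geom_sum n x / x ^ n))
      = x ^ n * elasticity n x"
    using eventually_gt_at_top[of 0]
    by eventually_elim (simp add: elasticity_def)
  ultimately show ?thesis by (simp add: Lim_transform_eventually)
qed

text \<open>
  Hence, in a sum of elasticities, only the terms with the smallest index survive the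
  normalisation by that power of \<open>x\<close>. This is how the set \<open>J\<close> enters the limit.
\<close>

lemma elasticity_scaled_at_top:
  assumes "0 < m" "m \<le> n"
  shows "((\<lambda>x. x ^ m * elasticity n x) \<longlongrightarrow> (if n = m then real m else 0)) at_top"
proof -
  have "((\<lambda>x. (x ^ m / x ^ n) * (x ^ n * elasticity n x)) \<longlongrightarrow> of_bool (m = n) * real n) at_top"
    using assms by (intro tendsto_intros power_quotient_at_top elasticity_at_top) auto
  moreover have "\<forall>\<^sub>F x::real in at_top. (x ^ m / x ^ n) * (x ^ n * elasticity n x) = x ^ m * elasticity n x"
    using eventually_gt_at_top[of 0] by eventually_elim auto
  ultimately have "((\<lambda>x. x ^ m * elasticity n x) \<longlongrightarrow> of_bool (m = n) * real n) at_top"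
    by (rule Lim_transform_eventually)
  then show ?thesis by (simp add: of_bool_def eq_commute split: if_splits)
qed

context root_reward_tree
begin

section \<open>Parents, children and geodesics\<close>

abbreviation depth :: "'a \<Rightarrow> nat" where
  "depth \<equiv> gdist G r"

definition children :: "'a \<Rightarrow> 'a set" where
  "children v = {c \<in> nbrs G v. depth v < depth c}"

definition parent :: "'a \<Rightarrow> 'a" where
  "parent v = (THE u. u \<in> nbrs G v \<and> depth u < depth v)"

lemma nbrs_sym: "u \<in> nbrs G v \<Longrightarrow> v \<in> nbrs G u"
  unfolding nbrs_def using graph_symmetric by auto

lemma nbrs_arc:
  assumes "u \<in> nbrs G v"
  obtains e where "e \<in> arcs G" "tail G e = v" "head G e = u"
  using assms unfolding nbrs_def arcs_ends_conv by auto

lemma arc_nbrs: "e \<in> arcs G \<Longrightarrow> head G e \<in> nbrs G (tail G e)"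
  unfolding nbrs_def arcs_ends_conv by auto

lemma nbrs_in_verts: "u \<in> nbrs G v \<Longrightarrow> u \<in> verts G" "u \<in> nbrs G v \<Longrightarrow> v \<in> verts G"
  by (auto elim!: nbrs_arc)

lemma finite_nbrs [simp]: "finite (nbrs G v)"
  by (rule finite_subset[OF _ finite_verts]) (auto dest: nbrs_in_verts)

lemma not_nbr_self: "v \<notin> nbrs G v"
  using no_loops by (metis nbrs_arc)

lemma root_in_verts: "r \<in> verts G"
  using root_leaf by (auto simp: leaves_def)

lemma leaves_in_verts: "v \<in> leaves G \<Longrightarrow> v \<in> verts G"
  and inner_in_verts: "v \<in> inner_verts G \<Longrightarrow> v \<in> verts G"
  by (auto simp: leaves_def inner_verts_def)

lemma inner_not_root: "v \<in> inner_verts G \<Longrightarrow> v \<noteq> r"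
  using root_leaf by (auto simp: inner_verts_def)

lemma walk_exists: 
  assumes "u \<in> verts G" "v \<in> verts G"
  shows "\<exists>p. awalk u p v"
proof -
  have "strongly_connected G"
    using connected sym_arcs by (simp add: symmetric_connected_imp_strongly_connected)
  then show ?thesis
    using assms by (auto simp: strongly_connected_def reachable_awalk)
qed

lemma awalk_snoc:
  assumes "awalk u p v" "e \<in> arcs G" "tail G e = v" "head G e = w"
  shows "awalk u (p @ [e]) w"
  using awalk_appendI assms arc_implies_awalk by blast

lemma shortest_walk:
  assumes "v \<in> verts G"
  shows "\<exists>p. awalk r p v \<and> length p = depth v"
proof -
  have "\<exists>n p. awalk r p v \<and> length p = n"
    using walk_exists[OF root_in_verts assms] by blast
  then show ?thesis unfolding gdist_def by (rule LeastI_ex)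
qed

lemma depth_le_length: "awalk r p v \<Longrightarrow> depth v \<le> length p"
  unfolding gdist_def by (rule Least_le) blast

lemma depth_root [simp]: "depth r = 0"
  using depth_le_length[of "[]" r] root_in_verts by (simp add: awalk_Nil_iff)

lemma depth_pos: "v \<in> verts G \<Longrightarrow> v \<noteq> r \<Longrightarrow> 0 < depth v"
  using shortest_walk[of v] awalk_empty_ends by (metis length_0_conv neq0_conv)

lemma depth_nbr_le:
  assumes "u \<in> nbrs G v"
  shows "depth u \<le> Suc (depth v)"
proof -
  obtain p where p: "awalk r p v" "length p = depth v"
    using shortest_walk nbrs_in_verts assms by blast
  obtain e where e: "e \<in> arcs G" "tail G e = v" "head G e = u"
    using assms by (rule nbrs_arc)
  have "awalk r (p @ [e]) u"
    using awalk_snoc[OF p(1)] e by blast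
  from depth_le_length[OF this] show ?thesis using p(2) by simp
qed

lemma shortest_walk_snoc:
  assumes "awalk r (q @ [e]) v" "length (q @ [e]) = depth v"
  shows "awalk r q (tail G e)" "tail G e \<in> nbrs G v"
    "length q = depth (tail G e)" "depth v = Suc (depth (tail G e))"
proof -
  have w: "awalk r q (awlast r q)" "awalk (awlast r q) [e] v"
    using assms(1) by auto
  then have e: "e \<in> arcs G" "awlast r q = tail G e" "head G e = v"
    by (auto simp: awalk_simps)
  show q: "awalk r q (tail G e)" using w e by simp
  show n: "tail G e \<in> nbrs G v" using arc_nbrs[OF e(1)] e(3) nbrs_sym by blast
  have "depth (tail G e) \<le> length q" "depth v \<le> Suc (depth (tail G e))"
    using depth_le_length[OF q] depth_nbr_le[OF nbrs_sym[OF n]] by auto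
  then show "length q = depth (tail G e)" "depth v = Suc (depth (tail G e))"
    using assms(2) by auto
qed

lemma nearer_nbr_exists:
  assumes "v \<in> verts G" "v \<noteq> r"
  shows "\<exists>u \<in> nbrs G v. depth v = Suc (depth u)"
proof -
  obtain p where p: "awalk r p v" "length p = depth v"
    using shortest_walk assms(1) by blast
  moreover have "p \<noteq> []" using p depth_pos[OF assms] by auto
  then obtain q e where "p = q @ [e]" using rev_exhaust by blast
  ultimately show ?thesis using shortest_walk_snoc by blast
qed

text \<open>
  Descending step by step to the root from \<open>u\<close>, the depth strictly decreases, so a vertex
  \<open>v \<noteq> u\<close> that is at least as deep as \<open>u\<close> is never met.
\<close>

lemma walks_avoiding_farther_vertex:
  assumes "u \<in> verts G" "u \<noteq> v" "depth u \<le> depth v"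
  shows "\<exists>p q. awalk u p r \<and> awalk r q u \<and> v \<notin> set (awalk_verts u p) \<and> v \<notin> set (awalk_verts r q)"
  using assms
proof (induction "depth u" arbitrary: u)
  case 0
  then have "u = r" using depth_pos by force
  then show ?case using 0 root_in_verts by (intro exI[of _ "[]"]) (auto simp: awalk_Nil_iff)
next
  case (Suc n)
  then have "u \<noteq> r" by auto
  then obtain w where w: "w \<in> nbrs G u" "depth u = Suc (depth w)"
    using nearer_nbr_exists Suc by blast
  moreover from w have "w \<in> verts G" "w \<noteq> v" "depth w \<le> depth v"
    using Suc.prems nbrs_in_verts by auto
  ultimately obtain p q where pq: "awalk w p r" "awalk r q w"
      "v \<notin> set (awalk_verts w p)" "v \<notin> set (awalk_verts r q)"
    using Suc.hyps by (metis Suc_inject)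
  obtain e where e: "e \<in> arcs G" "tail G e = u" "head G e = w" using w nbrs_arc by blast
  obtain f where f: "f \<in> arcs G" "tail G f = w" "head G f = u" using w nbrs_sym nbrs_arc by blast
  have 1: "awalk u (e # p) r" using e pq by (simp add: awalk_Cons_iff)
  have f1: "awalk w [f] u" using arc_implies_awalk f by blast
  have 2: "awalk r (q @ [f]) u" using pq(2) f1 by (rule awalk_appendI)
  have 3: "v \<notin> set (awalk_verts u (e # p))" using Suc.prems e pq by simp
  have 4: "v \<notin> set (awalk_verts r (q @ [f]))"
    unfolding set_awalk_verts_append[OF pq(2) f1]
    using Suc.prems pq f \<open>w \<noteq> v\<close> by auto
  from 1 2 3 4 show ?case by blast
qed

text \<open>
  This is where acyclicity is used. Two distinct neighbours \<open>u\<close>, \<open>u'\<close> of \<open>v\<close>, neither deeper than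
  \<open>v\<close>, are joined through the root by a walk avoiding \<open>v\<close>. A path extracted from that walk
  closes up at \<open>v\<close> to a cycle, of length at least three since \<open>u \<noteq> u'\<close>.
\<close>

lemma nearer_nbr_unique:
  assumes "u \<in> nbrs G v" "u' \<in> nbrs G v" "depth u \<le> depth v" "depth u' \<le> depth v"
  shows "u = u'"
proof (rule ccontr)
  assume "u \<noteq> u'"
  have "u \<noteq> v" "u' \<noteq> v" using assms not_nbr_self by auto
  obtain p where p: "awalk u p r" "v \<notin> set (awalk_verts u p)"
    using walks_avoiding_farther_vertex[of u v] assms \<open>u \<noteq> v\<close> nbrs_in_verts by blast
  obtain q where q: "awalk r q u'" "v \<notin> set (awalk_verts r q)"
    using walks_avoiding_farther_vertex[of u' v] assms \<open>u' \<noteq> v\<close> nbrs_in_verts by blast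
  have pq: "awalk u (p @ q) u'" using p(1) q(1) by (rule awalk_appendI)
  have v: "v \<notin> set (awalk_verts u (p @ q))"
    using p q set_awalk_verts_append[OF p(1) q(1)] by auto
  define s where "s = awalk_to_apath (p @ q)"
  have s: "awalk u s u'" "distinct (awalk_verts u s)" "set s \<subseteq> set (p @ q)"
    using apath_awalk_to_apath[OF pq] awalk_to_apath_subset[OF pq]
    by (auto simp: s_def apath_def)
  have vs: "v \<notin> set (awalk_verts u s)"
    using v s(3) unfolding set_awalk_verts[OF s(1)] set_awalk_verts[OF pq] by auto
  obtain e where e: "e \<in> arcs G" "tail G e = v" "head G e = u" using assms nbrs_arc by blast
  obtain f where f: "f \<in> arcs G" "tail G f = u'" "head G f = v"
    using assms nbrs_sym nbrs_arc by blast
  have sf: "awalk u (s @ [f]) v"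
    using awalk_snoc[OF s(1)] f by blast
  have "awalk_verts u (s @ [f]) = awalk_verts u s @ [v]"
    using awalk_verts_append[OF sf] f by simp
  then have "distinct (tl (awalk_verts v (e # s @ [f])))"
    using e s(2) vs by simp
  moreover have "awalk v (e # s @ [f]) v" using e sf by (simp only: awalk_Cons_iff)
  ultimately have "cycle (e # s @ [f])" unfolding cycle_def by blast
  moreover have "s \<noteq> []" using s(1) \<open>u \<noteq> u'\<close> by (auto simp: awalk_Nil_iff)
  then have "3 \<le> length (e # s @ [f])" by (cases s) auto
  ultimately show False using acyclic by blast
qed

lemma parent_eqI:
  assumes "u \<in> nbrs G v" "depth u < depth v"
  shows "parent v = u"
  unfolding parent_def using assms nearer_nbr_unique by (intro the_equality) auto

lemma
  assumes "v \<in> verts G" "v \<noteq> r"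
  shows parent_in_nbrs: "parent v \<in> nbrs G v"
    and depth_parent: "depth v = Suc (depth (parent v))"
    and parent_in_verts: "parent v \<in> verts G"
proof -
  obtain u where u: "u \<in> nbrs G v" "depth v = Suc (depth u)"
    using nearer_nbr_exists assms by blast
  then have "parent v = u" by (intro parent_eqI) auto
  with u show "parent v \<in> nbrs G v" "depth v = Suc (depth (parent v))" "parent v \<in> verts G"
    using nbrs_in_verts by auto
qed

lemma nbrs_eq:
  assumes "v \<in> verts G" "v \<noteq> r"
  shows "nbrs G v = insert (parent v) (children v)"
  using parent_in_nbrs[OF assms] depth_parent[OF assms] nearer_nbr_unique[of _ v "parent v"]
  by (fastforce simp: children_def)

lemma children_root: "children r = nbrs G r"
  using depth_pos not_nbr_self by (fastforce simp: children_def dest: nbrs_in_verts)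

lemma
  assumes "c \<in> children v"
  shows child_in_verts: "c \<in> verts G" and child_not_root: "c \<noteq> r"
    and parent_child: "parent c = v" and depth_child: "depth c = Suc (depth v)"
proof -
  have c: "c \<in> nbrs G v" "depth v < depth c" using assms by (auto simp: children_def)
  show "c \<in> verts G" using c nbrs_in_verts by blast
  show "c \<noteq> r" using c by auto
  show p: "parent c = v" using c nbrs_sym by (intro parent_eqI) auto
  show "depth c = Suc (depth v)" using depth_parent[OF \<open>c \<in> verts G\<close> \<open>c \<noteq> r\<close>] p by simp
qed

lemma finite_children [simp]: "finite (children v)"
  by (simp add: children_def)

lemma child_of_parent:
  assumes "v \<in> verts G" "v \<noteq> r"
  shows "v \<in> children (parent v)"
  using parent_in_nbrs[OF assms] depth_parent[OF assms] nbrs_sym by (auto simp: children_def)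

lemma parent_not_child: "v \<in> verts G \<Longrightarrow> v \<noteq> r \<Longrightarrow> parent v \<notin> children v"
  using depth_parent[of v] by (auto simp: children_def)

lemma card_nbrs:
  assumes "v \<in> verts G" "v \<noteq> r"
  shows "card (nbrs G v) = Suc (card (children v))"
  using parent_not_child[OF assms] by (simp add: nbrs_eq[OF assms])

lemma leaf_iff_no_children:
  assumes "v \<in> verts G" "v \<noteq> r"
  shows "v \<in> leaves G \<longleftrightarrow> children v = {}"
  using card_nbrs[OF assms] assms by (auto simp: leaves_def)

lemma parent_inner:
  assumes "v \<in> verts G" "v \<noteq> r" "parent v \<noteq> r"
  shows "parent v \<in> inner_verts G"
  using leaf_iff_no_children[of "parent v"] child_of_parent[of v] parent_in_verts[of v] assms
  by (auto simp: inner_verts_def)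

lemma geodesic_root: "geodesic_verts G r r = {r}"
  using root_in_verts by (auto simp: geodesic_verts_def awalk_Nil_iff)

text \<open>
  The last arc of a shortest walk from the root starts at a neighbour that is nearer to the root,
  and the parent is the only one. So geodesics from the root are generated by passing to the
  parent, which reduces all statements about them to induction along parents.
\<close>

lemma geodesic_step:
  assumes "v \<in> verts G" "v \<noteq> r"
  shows "geodesic_verts G r v = insert v (geodesic_verts G r (parent v))"
proof -
  have last: "awalk_verts r (q @ [e]) = awalk_verts r q @ [v]"
    if "awalk r (q @ [e]) v" for q e
    using awalk_verts_append[OF that] that by (auto simp: awalk_simps)
  have 1: "w = v \<or> w \<in> geodesic_verts G r (parent v)" if w: "w \<in> geodesic_verts G r v" for w
  proof -
    obtain p where p: "awalk r p v" "length p = depth v" "w \<in> set (awalk_verts r p)"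
      using w unfolding geodesic_verts_def by blast
    have "p \<noteq> []" using p depth_pos[OF assms] by auto
    then obtain q e where qe: "p = q @ [e]" using rev_exhaust by blast
    note s = shortest_walk_snoc[OF p(1)[unfolded qe] p(2)[unfolded qe]]
    have "parent v = tail G e" using s by (intro parent_eqI) auto
    moreover have "w = v \<or> w \<in> set (awalk_verts r q)"
      using last[of q e] p qe by auto
    ultimately show ?thesis using s unfolding geodesic_verts_def by auto
  qed
  have 2: "w \<in> geodesic_verts G r v"
    if w: "w \<in> set (awalk_verts r q) \<or> w = v"
      and q: "awalk r q (parent v)" "length q = depth (parent v)" for w q
  proof -
    obtain e where e: "e \<in> arcs G" "tail G e = parent v" "head G e = v"
      using parent_in_nbrs[OF assms] nbrs_sym nbrs_arc by blast
    have a: "awalk r (q @ [e]) v"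
      using awalk_snoc[OF q(1)] e by blast
    moreover have "length (q @ [e]) = depth v" using q depth_parent[OF assms] by simp
    moreover have "w \<in> set (awalk_verts r (q @ [e]))" using last[OF a] w by auto
    ultimately show ?thesis unfolding geodesic_verts_def by blast
  qed
  obtain q0 where "awalk r q0 (parent v)" "length q0 = depth (parent v)"
    using shortest_walk parent_in_verts assms by blast
  then have "v \<in> geodesic_verts G r v" using 2 by blast
  moreover have "geodesic_verts G r (parent v) \<subseteq> geodesic_verts G r v"
    using 2 by (auto simp: geodesic_verts_def[of G r "parent v"])
  ultimately show ?thesis using 1 by blast
qed

lemma rooted_induct [consumes 1, case_names root step]:
  assumes "v \<in> verts G" "P r"
    "\<And>v. v \<in> verts G \<Longrightarrow> v \<noteq> r \<Longrightarrow> P (parent v) \<Longrightarrow> P v"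
  shows "P v"
  using assms(1)
proof (induction "depth v" arbitrary: v rule: less_induct)
  case less
  show ?case
  proof (cases "v = r")
    case False
    have "P (parent v)"
      using less False depth_parent[of v] parent_in_verts[of v] by simp
    then show ?thesis using assms(3)[of v] less False by blast
  qed (simp add: assms)
qed

text \<open>
  The root is left out: every other vertex contributes one factor to \<open>h\<close>, the root none.
\<close>

definition root_path :: "'a \<Rightarrow> 'a set" where
  "root_path v = geodesic_verts G r v - {r}"

lemma root_path_root: "root_path r = {}"
  by (simp add: root_path_def geodesic_root)

lemma root_path_step: "v \<in> verts G \<Longrightarrow> v \<noteq> r \<Longrightarrow> root_path v = insert v (root_path (parent v))"
  by (auto simp: root_path_def geodesic_step)

lemma root_path_depth: "v \<in> verts G \<Longrightarrow> w \<in> root_path v \<Longrightarrow> depth w \<le> depth v"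
proof (induction v arbitrary: w rule: rooted_induct)
  case (step v)
  then show ?case using depth_parent[of v] by (fastforce simp: root_path_step)
qed (simp add: root_path_root)

lemma root_path_fresh: "v \<in> verts G \<Longrightarrow> v \<noteq> r \<Longrightarrow> v \<notin> root_path (parent v)"
  using root_path_depth[of "parent v" v] depth_parent[of v] parent_in_verts[of v] by auto

lemma finite_root_path: "v \<in> verts G \<Longrightarrow> finite (root_path v)"
  by (induction v rule: rooted_induct) (auto simp: root_path_root root_path_step)

lemma card_root_path: "v \<in> verts G \<Longrightarrow> card (root_path v) = depth v"
  by (induction v rule: rooted_induct)
    (auto simp: root_path_root root_path_step root_path_fresh finite_root_path parent_in_verts depth_parent)

lemma root_in_geodesic: "v \<in> verts G \<Longrightarrow> r \<in> geodesic_verts G r v"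
  by (induction v rule: rooted_induct) (auto simp: geodesic_root geodesic_step)

lemma geodesic_eq: "v \<in> verts G \<Longrightarrow> geodesic_verts G r v = insert r (root_path v)"
  using root_in_geodesic by (auto simp: root_path_def)

lemma root_path_inner: "v \<in> inner_verts G \<Longrightarrow> root_path v \<subseteq> inner_verts G"
proof -
  have "v \<in> inner_verts G \<longrightarrow> root_path v \<subseteq> inner_verts G" if "v \<in> verts G"
    using that
  proof (induction v rule: rooted_induct)
    case (step v)
    then show ?case using parent_inner[of v] by (cases "parent v = r") (auto simp: root_path_step root_path_root)
  qed (simp add: root_path_root)
  then show "v \<in> inner_verts G \<Longrightarrow> root_path v \<subseteq> inner_verts G" using inner_in_verts by blast
qed

lemma root_path_meets_root_children: "v \<in> verts G \<Longrightarrow> v \<noteq> r \<Longrightarrow> \<exists>c \<in> root_path v. c \<in> nbrs G r"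
proof (induction v rule: rooted_induct)
  case (step v)
  then show ?case
    using nbrs_sym[OF parent_in_nbrs[of v]] by (cases "parent v = r") (auto simp: root_path_step)
qed simp

section \<open>Distance to the unrewarded leaves\<close>

text \<open>
  The relation whose least length is \<^const>\<open>d_out\<close>, isolated so that it can be unfolded one arc
  at a time.
\<close>

definition outward :: "'a \<Rightarrow> nat \<Rightarrow> bool" where
  "outward v n \<longleftrightarrow> (\<exists>p. \<exists>b \<in> leaves G - {r}. awalk v p b \<and> length p = n \<and>
     (\<forall>e \<in> set p. depth (tail G e) < depth (head G e)))"

lemma d_out_Least: "d_out G r v = (LEAST n. outward v n)"
  by (simp add: d_out_def outward_def)

lemma outward_0: "outward v 0 \<longleftrightarrow> v \<in> leaves G - {r}"
  using leaves_in_verts by (auto simp: outward_def awalk_Nil_iff)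

lemma outward_Suc: "outward v (Suc n) \<longleftrightarrow> (\<exists>c \<in> children v. outward c n)"
proof
  assume "outward v (Suc n)"
  then obtain p b where p: "b \<in> leaves G - {r}" "awalk v p b" "length p = Suc n"
      "\<forall>e \<in> set p. depth (tail G e) < depth (head G e)"
    unfolding outward_def by blast
  obtain e q where eq: "p = e # q" using p(3) by (cases p) auto
  have "head G e \<in> children v"
    using arc_nbrs[of e] p eq by (auto simp: children_def awalk_Cons_iff)
  moreover have "outward (head G e) n"
    unfolding outward_def using p eq
    by (intro exI[of _ q] bexI[of _ b]) (auto simp: awalk_Cons_iff)
  ultimately show "\<exists>c \<in> children v. outward c n" by blast
next
  assume "\<exists>c \<in> children v. outward c n"
  then obtain c q b where c: "c \<in> children v" and q: "b \<in> leaves G - {r}" "awalk c q b" "length q = n"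
      "\<forall>e \<in> set q. depth (tail G e) < depth (head G e)"
    unfolding outward_def by blast
  obtain e where e: "e \<in> arcs G" "tail G e = v" "head G e = c"
    using c nbrs_arc by (auto simp: children_def)
  have "awalk v (e # q) b" using e q by (simp add: awalk_Cons_iff)
  moreover have "\<forall>f \<in> set (e # q). depth (tail G f) < depth (head G f)"
    using q e c by (auto simp: children_def)
  ultimately show "outward v (Suc n)" unfolding outward_def using q
    by (intro exI[of _ "e # q"] bexI[of _ b]) auto
qed

lemma root_has_child: "children r \<noteq> {}"
  using root_leaf by (auto simp: children_root leaves_def)

text \<open>
  Moving from a vertex to any child increases the depth, which is bounded, so the descent ends in a
  leaf other than the root.
\<close>

lemma outward_exists: "v \<in> verts G \<Longrightarrow> \<exists>n. outward v n"
proof (induction "Max (depth ` verts G) - depth v" arbitrary: v rule: less_induct)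
  case less
  show ?case
  proof (cases "children v = {}")
    case True
    then have "v \<in> leaves G - {r}"
      using less.prems leaf_iff_no_children root_has_child by blast
    then show ?thesis using outward_0 by blast
  next
    case False
    then obtain c where c: "c \<in> children v" by blast
    have "depth c \<le> Max (depth ` verts G)" using child_in_verts[OF c] by (intro Max_ge) auto
    then have "\<exists>n. outward c n"
      using depth_child[OF c] child_in_verts[OF c] by (intro less.hyps) auto
    then show ?thesis using c outward_Suc by blast
  qed
qed

lemma d_out_leaf: "b \<in> leaves G \<Longrightarrow> b \<noteq> r \<Longrightarrow> d_out G r b = 0"
  using Least_le[of "outward b" 0] by (simp add: d_out_Least outward_0)

lemma outward_d_out: "v \<in> verts G \<Longrightarrow> outward v (d_out G r v)"
  unfolding d_out_Least using outward_exists LeastI_ex by blast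

lemma d_out_le: "outward v n \<Longrightarrow> d_out G r v \<le> n"
  unfolding d_out_Least by (rule Least_le)

lemma d_out_step:
  assumes "v \<in> verts G" "v \<notin> leaves G - {r}"
  obtains c where "c \<in> children v" "d_out G r v = Suc (d_out G r c)"
    "\<And>c'. c' \<in> children v \<Longrightarrow> d_out G r c \<le> d_out G r c'"
proof -
  have le: "d_out G r v \<le> Suc (d_out G r c')" if "c' \<in> children v" for c'
    using outward_d_out[OF child_in_verts[OF that]] that outward_Suc d_out_le by blast
  have "d_out G r v \<noteq> 0" using outward_d_out[OF assms(1)] assms(2) outward_0 by metis
  then obtain n where n: "d_out G r v = Suc n" using not0_implies_Suc by blast
  then obtain c where c: "c \<in> children v" "outward c n"
    using outward_d_out[OF assms(1)] outward_Suc by auto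
  have "d_out G r c = n" using le[OF c(1)] d_out_le[OF c(2)] n by simp
  with that c n le show ?thesis by fastforce
qed

lemma d_out_inner_pos: "v \<in> inner_verts G \<Longrightarrow> 0 < d_out G r v"
  by (rule d_out_step[of v]) (auto simp: inner_verts_def)

lemma d_out_root:
  assumes "c \<in> nbrs G r"
  shows "d_out G r r = Suc (d_out G r c)"
proof -
  have "card (nbrs G r) = 1" using root_leaf by (simp add: leaves_def)
  then have "\<And>c'. c' \<in> nbrs G r \<Longrightarrow> c' = c" using assms by (auto simp: card_1_singleton_iff)
  moreover obtain c' where "c' \<in> children r" "d_out G r r = Suc (d_out G r c')"
    using d_out_step[OF root_in_verts] by blast
  ultimately show ?thesis using children_root by auto
qed

context
  fixes v assumes v: "v \<in> inner_verts G"
begin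

text \<open>
  The geodesic in \<^const>\<open>d_out_min\<close> and \<^const>\<open>J_set\<close> contains the root, which carries no factor
  of \<open>h\<close>. The minimum is never attained there: the single child of the root lies on the geodesic
  too, and its value of \<^const>\<open>d_out\<close> is smaller by one.
\<close>

lemma d_out_min_eq: "d_out_min G r v = Min (d_out G r ` root_path v)"
  and J_set_eq: "J_set G r v = {w \<in> root_path v. d_out G r w = d_out_min G r v}"
proof -
  have vv: "v \<in> verts G" "v \<noteq> r" using v inner_in_verts inner_not_root by auto
  obtain c where c: "c \<in> root_path v" "c \<in> nbrs G r" using root_path_meets_root_children vv by blast
  have fin: "finite (d_out G r ` root_path v)" using finite_root_path[OF vv(1)] by simp
  have "Min (d_out G r ` root_path v) \<le> d_out G r c" using c fin by (intro Min_le) auto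
  then have less: "Min (d_out G r ` root_path v) < d_out G r r" using d_out_root[OF c(2)] by simp
  show eq: "d_out_min G r v = Min (d_out G r ` root_path v)"
    unfolding d_out_min_def geodesic_eq[OF vv(1)]
    using c fin less by (subst image_insert, subst Min_insert) auto
  show "J_set G r v = {w \<in> root_path v. d_out G r w = d_out_min G r v}"
    unfolding J_set_def geodesic_eq[OF vv(1)] using less eq by auto
qed

lemma d_out_min_le: "w \<in> root_path v \<Longrightarrow> d_out_min G r v \<le> d_out G r w"
  unfolding d_out_min_eq using finite_root_path inner_in_verts v by (intro Min_le) auto

lemma self_in_root_path: "v \<in> root_path v"
  using root_path_step v inner_in_verts inner_not_root by blast

lemma d_out_min_pos: "0 < d_out_min G r v"
  and J_set_nonempty: "J_set G r v \<noteq> {}"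
proof -
  have "d_out_min G r v \<in> d_out G r ` root_path v"
    unfolding d_out_min_eq using finite_root_path inner_in_verts v self_in_root_path by (intro Min_in) auto
  then obtain w where w: "w \<in> root_path v" "d_out G r w = d_out_min G r v" by auto
  then show "0 < d_out_min G r v" using root_path_inner[OF v] d_out_inner_pos[of w] by auto
  show "J_set G r v \<noteq> {}" using w unfolding J_set_eq by auto
qed

end

section \<open>Uniqueness of the biased infinity harmonic function\<close>

lemma nbr_closed_set_everything:
  assumes "v \<in> S" "v \<in> verts G" "\<And>v. v \<in> S \<Longrightarrow> v \<in> verts G \<Longrightarrow> nbrs G v \<subseteq> S"
  shows "verts G \<subseteq> S"
proof
  fix w assume "w \<in> verts G"
  then obtain p where "awalk v p w" using walk_exists assms by blast
  then show "w \<in> S"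
    using assms(1,2)
  proof (induction p arbitrary: v)
    case Nil
    then show ?case by (simp add: awalk_Nil_iff)
  next
    case (Cons e p)
    then have e: "e \<in> arcs G" "tail G e = v" "awalk (head G e) p w"
      by (auto simp: awalk_Cons_iff)
    have "head G e \<in> S" using arc_nbrs[OF e(1)] e(2) assms(3) Cons.prems by blast
    then show ?case using Cons.IH e(1,3) by simp
  qed
qed

lemma inner_nbrs_nonempty: "v \<in> inner_verts G \<Longrightarrow> nbrs G v \<noteq> {}"
  using parent_in_nbrs inner_in_verts inner_not_root by blast

text \<open>
  A comparison principle. Suppose that \<open>f - g\<close> has a positive maximum \<open>M\<close>, and among the vertices
  attaining it consider those where \<open>f\<close> is largest. At such a vertex both extremal neighbour values
  of \<open>f\<close> must exceed those of \<open>g\<close> by exactly \<open>M\<close>. A neighbour that maximises \<open>f\<close> then also attains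
  \<open>M\<close>, so it does not exceed the vertex; since both weights are positive, \<open>f\<close> is
  constant around the vertex, and so is \<open>g\<close>. The set of these vertices is thus closed under
  neighbours and contains the root, where \<open>f - g\<close> vanishes.
\<close>

lemma harmonic_le:
  assumes f: "is_biased_infinity_harmonic G r l f"
    and g: "is_biased_infinity_harmonic G r l g"
    and l: "0 < l" and v: "v \<in> verts G"
  shows "f v \<le> g v"
proof (rule ccontr)
  assume "\<not> f v \<le> g v"
  define M where "M = Max ((\<lambda>v. f v - g v) ` verts G)"
  define A where "A = {v \<in> verts G. f v - g v = M}"
  define F where "F = Max (f ` A)"
  define S where "S = {v \<in> A. f v = F}"
  have M_ge: "f w - g w \<le> M" if "w \<in> verts G" for w
    unfolding M_def using that by (intro Max_ge) auto
  have "0 < M" using M_ge[OF v] \<open>\<not> f v \<le> g v\<close> by simp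
  have "M \<in> (\<lambda>v. f v - g v) ` verts G"
    unfolding M_def using v by (intro Max_in) auto
  then have "A \<noteq> {}" by (auto simp: A_def)
  have "finite A" by (simp add: A_def)
  have F_ge: "f w \<le> F" if "w \<in> A" for w
    unfolding F_def using that \<open>finite A\<close> by (intro Max_ge) auto
  have "F \<in> f ` A"
    unfolding F_def using \<open>finite A\<close> \<open>A \<noteq> {}\<close> by (intro Max_in) auto
  then obtain s where s: "s \<in> S" by (auto simp: S_def)
  have leaf: "f w = g w" if "w \<in> leaves G" for w
    using f g that by (auto simp: is_biased_infinity_harmonic_def)
  have closed: "nbrs G w \<subseteq> S" if w: "w \<in> S" for w
  proof -
    have wM: "f w - g w = M" "f w = F" "w \<in> verts G"
      using w by (auto simp: S_def A_def)
    then have "w \<in> inner_verts G" using leaf \<open>0 < M\<close> by (auto simp: inner_verts_def)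
    let ?N = "nbrs G w"
    have N: "?N \<noteq> {}" using \<open>w \<in> inner_verts G\<close> by (rule inner_nbrs_nonempty)
    define a b where "a = l / (l + 1)" and "b = 1 / (l + 1)"
    have ab: "0 < a" "0 < b" "a + b = 1"
      using l by (auto simp: a_def b_def add_divide_distrib[symmetric])
    define Mf mf Mg mg where defs: "Mf = Max (f ` ?N)" "mf = Min (f ` ?N)"
      "Mg = Max (g ` ?N)" "mg = Min (g ` ?N)"
    have fw: "f w = a * Mf + b * mf" and gw: "g w = a * Mg + b * mg"
      using f g \<open>w \<in> inner_verts G\<close>
      by (auto simp: is_biased_infinity_harmonic_def a_def b_def defs)
    have f_bd: "mf \<le> f u" "f u \<le> Mf" and g_bd: "mg \<le> g u" "g u \<le> Mg"
      if "u \<in> ?N" for u using that by (auto simp: defs)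
    have "Mf \<in> f ` ?N" "mg \<in> g ` ?N" unfolding defs using N by (auto intro!: Max_in Min_in)
    then obtain u u' where u: "u \<in> ?N" "f u = Mf" and u': "u' \<in> ?N" "g u' = mg" by auto
    have u_verts: "u \<in> verts G" "u' \<in> verts G" using u u' nbrs_in_verts by auto
    have le: "Mf \<le> Mg + M" "mf \<le> mg + M"
      using M_ge[OF u_verts(1)] M_ge[OF u_verts(2)] g_bd[OF u(1)] f_bd[OF u'(1)] u u' by auto
    have "a * (Mg + M - Mf) + b * (mg + M - mf) = (a + b) * M - (f w - g w)"
      using fw gw by (simp add: algebra_simps)
    then have "a * (Mg + M - Mf) + b * (mg + M - mf) = 0" using ab wM by simp
    moreover have "0 \<le> a * (Mg + M - Mf)" "0 \<le> b * (mg + M - mf)" using ab le by auto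
    ultimately have "a * (Mg + M - Mf) = 0" "b * (mg + M - mf) = 0" by linarith+
    then have eq: "Mf = Mg + M" "mf = mg + M" using ab by auto
    have "u \<in> A" using M_ge[OF u_verts(1)] g_bd[OF u(1)] u u_verts eq by (auto simp: A_def)
    then have "Mf \<le> f w" using F_ge u wM by auto
    moreover have "mf \<le> Mf" using f_bd[OF u(1)] by simp
    moreover have "a * (f w - Mf) + b * (f w - mf) = (a + b) * f w - f w"
      using fw by (simp add: algebra_simps)
    then have "a * (f w - Mf) + b * (f w - mf) = 0" using ab by simp
    moreover have "0 \<le> a * (f w - Mf)" "0 \<le> b * (f w - mf)"
      using ab calculation by auto
    ultimately have "b * (f w - mf) = 0" by linarith
    then have "mf = f w" using ab by auto
    then have "Mf = f w" using \<open>Mf \<le> f w\<close> \<open>mf \<le> Mf\<close> by simp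
    show ?thesis
    proof
      fix x assume x: "x \<in> ?N"
      have "f x = F" using f_bd[OF x] \<open>mf = f w\<close> \<open>Mf = f w\<close> wM by simp
      moreover have "g x = F - M" using g_bd[OF x] eq \<open>mf = f w\<close> \<open>Mf = f w\<close> wM by simp
      ultimately show "x \<in> S" using x nbrs_in_verts by (auto simp: S_def A_def)
    qed
  qed
  have "s \<in> verts G" using s by (auto simp: S_def A_def)
  with s closed have "verts G \<subseteq> S" by (intro nbr_closed_set_everything) auto
  then have "f r - g r = M" using root_in_verts by (auto simp: S_def A_def)
  then show False using leaf[OF root_leaf] \<open>0 < M\<close> by simp
qed

lemma harmonic_unique:
  assumes "is_biased_infinity_harmonic G r l f" "is_biased_infinity_harmonic G r l g" "0 < l"
  shows "f = g"
proof (rule PiE_ext)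
  show "f \<in> verts G \<rightarrow>\<^sub>E {0..}" "g \<in> verts G \<rightarrow>\<^sub>E {0..}"
    using assms by (auto simp: is_biased_infinity_harmonic_def)
  show "f v = g v" if "v \<in> verts G" for v
    using harmonic_le assms that by (intro antisym) auto
qed

section \<open>The explicit solution\<close>

text \<open>
  The explicit solution. It vanishes at the leaves other than the root because these carry the
  factor \<open>decay 0 = 0\<close>. Outside the vertex set it takes the default value of extensional functions.
\<close>

definition profile :: "real \<Rightarrow> 'a \<Rightarrow> real" where
  "profile l v = (if v \<in> verts G then \<Prod>w\<in>root_path v. decay (d_out G r w) l else undefined)"

lemma profile_root: "profile l r = 1"
  using root_in_verts by (simp add: profile_def root_path_root)

lemma profile_step:
  assumes "v \<in> verts G" "v \<noteq> r"
  shows "profile l v = decay (d_out G r v) l * profile l (parent v)"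
  using assms finite_root_path[of "parent v"] root_path_fresh[of v] parent_in_verts[of v]
  by (simp add: profile_def root_path_step)

lemma profile_child:
  assumes "c \<in> children v"
  shows "profile l c = decay (d_out G r c) l * profile l v"
  using profile_step[OF child_in_verts[OF assms] child_not_root[OF assms]] parent_child[OF assms]
  by simp

lemma profile_nonneg: "0 \<le> l \<Longrightarrow> v \<in> verts G \<Longrightarrow> 0 \<le> profile l v"
  by (auto simp: profile_def intro!: prod_nonneg decay_nonneg)

lemma profile_pos: "0 < l \<Longrightarrow> v \<in> inner_verts G \<Longrightarrow> 0 < profile l v"
  using root_path_inner[of v] d_out_inner_pos inner_in_verts
  by (auto simp: profile_def intro!: prod_pos decay_pos)

text \<open>
  All factors lie between \<open>0\<close> and \<open>1\<close>, so the parent has the largest value. The values of the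
  children differ only by their last factor, and \<open>decay n l\<close> increases with \<open>n\<close>, so the smallest
  one belongs to the child with least \<^const>\<open>d_out\<close>.
\<close>

lemma profile_nbrs:
  assumes v: "v \<in> inner_verts G" and l: "0 < l"
  obtains n where "d_out G r v = Suc n"
    "Max (profile l ` nbrs G v) = profile l (parent v)"
    "Min (profile l ` nbrs G v) = decay n l * profile l v"
proof -
  have vv: "v \<in> verts G" "v \<noteq> r" using v inner_in_verts inner_not_root by auto
  obtain c where c: "c \<in> children v" "d_out G r v = Suc (d_out G r c)"
      and c_min: "\<And>c'. c' \<in> children v \<Longrightarrow> d_out G r c \<le> d_out G r c'"
    using d_out_step[OF vv(1)] v by (auto simp: inner_verts_def)
  have pos: "0 \<le> profile l v" "0 \<le> profile l (parent v)"
    using profile_nonneg l vv parent_in_verts by auto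
  have up: "profile l v \<le> profile l (parent v)"
    using profile_step[OF vv] decay_le_1[of l] pos l by (simp add: mult_left_le_one_le decay_nonneg)
  have down: "profile l c' \<le> profile l v" if "c' \<in> children v" for c'
    using profile_child[OF that] decay_le_1[of l] pos l by (simp add: mult_left_le_one_le decay_nonneg)
  have min: "profile l c \<le> profile l c'" if "c' \<in> children v" for c'
    using profile_child[OF c(1)] profile_child[OF that] c_min[OF that] pos l
    by (simp add: mult_right_mono decay_mono)
  have nb: "nbrs G v = insert (parent v) (children v)" using nbrs_eq[OF vv] .
  have "Max (profile l ` nbrs G v) = profile l (parent v)"
    using up down unfolding nb by (intro Max_eqI) force+
  moreover have "Min (profile l ` nbrs G v) = profile l c"
    using up down[OF c(1)] min c(1) unfolding nb by (intro Min_eqI) auto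
  ultimately show ?thesis using that c(2) profile_child[OF c(1)] by simp
qed

lemma profile_harmonic:
  assumes l: "0 < l"
  shows "is_biased_infinity_harmonic G r l (profile l)"
  unfolding is_biased_infinity_harmonic_def
proof (intro conjI ballI)
  show "profile l \<in> verts G \<rightarrow>\<^sub>E {0..}"
    using profile_nonneg l by (auto simp: PiE_iff extensional_def) (simp add: profile_def)
next
  fix v assume "v \<in> leaves G"
  then show "profile l v = indicat_real {r} v"
    using profile_step[of v l] leaves_in_verts[of v] d_out_leaf[of v]
    by (cases "v = r") (auto simp: profile_root)
next
  fix v assume v: "v \<in> inner_verts G"
  have vv: "v \<in> verts G" "v \<noteq> r" using v inner_in_verts inner_not_root by auto
  obtain n where n: "d_out G r v = Suc n"
      "Max (profile l ` nbrs G v) = profile l (parent v)"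
      "Min (profile l ` nbrs G v) = decay n l * profile l v"
    using profile_nbrs[OF v l] by blast
  \<comment> \<open>The factor is the right-hand side of the recursion for \<open>decay\<close>.\<close>
  have "profile l v = (l / (l + 1) + 1 / (l + 1) * (decay n l * decay (Suc n) l)) * profile l (parent v)"
    unfolding decay_fixed_point[OF l, symmetric] using profile_step[OF vv] n(1) by simp
  then show "profile l v = l / (l + 1) * Max (profile l ` nbrs G v)
      + 1 / (l + 1) * Min (profile l ` nbrs G v)"
    using n profile_step[OF vv] by (simp add: distrib_right mult.assoc)
qed

lemma h_eq_profile: "0 < l \<Longrightarrow> h G r l = profile l"
  unfolding h_def using profile_harmonic harmonic_unique by (intro the_equality) blast+

section \<open>The stake and its limits\<close>

lemma Delta_eq:
  assumes v: "v \<in> inner_verts G" and l: "0 < l"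
  shows "Delta G r l v = profile l v * (l + 1) / (l * geom_sum (d_out G r v - 1) l)"
proof -
  have vv: "v \<in> verts G" "v \<noteq> r" using v inner_in_verts inner_not_root by auto
  obtain n where n: "d_out G r v = Suc n"
      "Max (profile l ` nbrs G v) = profile l (parent v)"
      "Min (profile l ` nbrs G v) = decay n l * profile l v"
    using profile_nbrs[OF v l] by blast
  have s: "profile l v = decay (Suc n) l * profile l (parent v)"
    using profile_step[OF vv] n(1) by simp
  have "Delta G r l v = (1 - decay n l * decay (Suc n) l) * profile l (parent v)"
    using n by (simp add: Delta_def h_eq_profile[OF l] s algebra_simps)
  also have "\<dots> = profile l v * (l + 1) / (l * geom_sum n l)"
    unfolding decay_spread[OF l] s by simp
  finally show ?thesis using n(1) by simp
qed

lemma DERIV_h: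
  assumes v: "v \<in> inner_verts G" and l: "0 < l"
  shows "((\<lambda>x. h G r x v) has_real_derivative
    profile l v * (\<Sum>w\<in>root_path v. elasticity (d_out G r w) l) / l) (at l)"
proof -
  have vv: "v \<in> verts G" using v inner_in_verts by auto
  have "((\<lambda>x. \<Prod>w\<in>root_path v. decay (d_out G r w) x) has_real_derivative
      (\<Prod>w\<in>root_path v. decay (d_out G r w) l) * (\<Sum>w\<in>root_path v. elasticity (d_out G r w) l / l)) (at l)"
    using finite_root_path[OF vv] root_path_inner[OF v] d_out_inner_pos l
    by (intro DERIV_prod_log DERIV_decay) auto
  then have "((\<lambda>x. profile x v) has_real_derivative
      profile l v * (\<Sum>w\<in>root_path v. elasticity (d_out G r w) l) / l) (at l)"
    using vv by (simp add: profile_def sum_divide_distrib[symmetric])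
  then show ?thesis
    by (rule has_field_derivative_transform_within_open[OF _ open_greaterThan[of 0]])
      (use l h_eq_profile in auto)
qed

text \<open>
  Numerator and denominator both contain the factor \<open>h(l, v)\<close>. After cancellation the stake depends
  on the tree only through the values of \<^const>\<open>d_out\<close> along the geodesic.
\<close>

lemma Stake_eq:
  assumes v: "v \<in> inner_verts G" and l: "0 < l"
  shows "Stake G r 1 l v =
    1 / ((l + 1) * geom_sum (d_out G r v - 1) l * (\<Sum>w\<in>root_path v. elasticity (d_out G r w) l))"
proof -
  have "deriv (\<lambda>x. h G r x v) l = profile l v * (\<Sum>w\<in>root_path v. elasticity (d_out G r w) l) / l"
    by (rule DERIV_imp_deriv[OF DERIV_h[OF v l]])
  then show ?thesis
    using l profile_pos[OF l v] geom_sum_pos[of l "d_out G r v - 1"]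
    by (simp add: Stake_def Delta_eq[OF v l] power2_eq_square)
qed

lemma Stake_tendsto_at_0:
  assumes v: "v \<in> inner_verts G"
  shows "((\<lambda>l. Stake G r 1 l v) \<longlongrightarrow> inverse (real (d_in G r v))) (at_right 0)"
proof -
  have vv: "v \<in> verts G" "v \<noteq> r" using v inner_in_verts inner_not_root by auto
  have "((\<lambda>l. (l + 1) * geom_sum (d_out G r v - 1) l * (\<Sum>w\<in>root_path v. elasticity (d_out G r w) l))
      \<longlongrightarrow> (0 + 1) * geom_sum (d_out G r v - 1) 0 * (\<Sum>w\<in>root_path v. 1)) (at_right 0)"
    using root_path_inner[OF v] d_out_inner_pos
    by (intro tendsto_intros elasticity_tendsto_at_0 tendsto_within_subset[OF DERIV_isCont[OF DERIV_geom_sum, unfolded isCont_def]]) auto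
  moreover have "geom_sum k 0 = 1" for k by (cases k) (auto simp: geom_sum_Suc)
  ultimately have "((\<lambda>l. 1 / ((l + 1) * geom_sum (d_out G r v - 1) l * (\<Sum>w\<in>root_path v. elasticity (d_out G r w) l)))
      \<longlongrightarrow> 1 / real (depth v)) (at_right 0)"
    using card_root_path[OF vv(1)] depth_pos[OF vv] by (intro tendsto_divide) auto
  moreover have "\<forall>\<^sub>F l in at_right 0.
      1 / ((l + 1) * geom_sum (d_out G r v - 1) l * (\<Sum>w\<in>root_path v. elasticity (d_out G r w) l)) = Stake G r 1 l v"
    using eventually_at_right_less[of 0] by eventually_elim (simp add: Stake_eq[OF v])
  ultimately show ?thesis
    by (auto simp: d_in_def inverse_eq_divide intro: Lim_transform_eventually)
qed

lemma Stake_at_1: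
  assumes v: "v \<in> inner_verts G"
  shows "Stake G r 1 1 v = inverse (real (d_out G r v)) * inverse (real (d_in G r v))"
proof -
  have "(\<Sum>w\<in>root_path v. elasticity (d_out G r w) 1) = (\<Sum>w\<in>root_path v. 1 / 2)"
    using root_path_inner[OF v] d_out_inner_pos by (intro sum.cong refl elasticity_at_1) auto
  then show ?thesis
    using card_root_path[OF inner_in_verts[OF v]] d_out_inner_pos[OF v]
    by (simp add: Stake_eq[OF v] geom_sum_at_1 of_nat_diff d_in_def field_simps)
qed

lemma Stake_scaled_at_top:
  assumes v: "v \<in> inner_verts G"
  shows "((\<lambda>l. l powi (int (d_out G r v) - int (d_out_min G r v)) * Stake G r 1 l v)
    \<longlongrightarrow> inverse (real (card (J_set G r v)) * real (d_out_min G r v))) at_top"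
proof -
  have fin: "finite (root_path v)" using finite_root_path inner_in_verts v by blast
  define D m where "D = d_out G r v" and "m = d_out_min G r v"
  have D: "0 < D" "m \<le> D" and m: "0 < m"
    using d_out_inner_pos[OF v] d_out_min_le[OF v self_in_root_path[OF v]] d_out_min_pos[OF v]
    by (auto simp: D_def m_def)
  have "(\<Sum>w\<in>root_path v. if d_out G r w = m then real m else 0)
      = (\<Sum>w\<in>{w \<in> root_path v. d_out G r w = m}. real m)"
    by (rule sum.inter_filter[OF fin, symmetric])
  also have "\<dots> = real (card (J_set G r v)) * real m"
    by (simp add: J_set_eq[OF v] m_def)
  finally have J: "(\<Sum>w\<in>root_path v. if d_out G r w = m then real m else 0)
      = real (card (J_set G r v)) * real m" .
  have J0: "card (J_set G r v) \<noteq> 0"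
    using J_set_nonempty[OF v] fin by (auto simp: J_set_eq[OF v])
  have lin: "((\<lambda>l::real. 1 + 1 / l) \<longlongrightarrow> 1 + 0) at_top"
    by (intro tendsto_intros tendsto_divide_0[OF tendsto_const] filterlim_at_top_imp_at_infinity filterlim_ident)
  \<comment> \<open>The denominator of the stake, with \<open>l ^ D\<close> divided out of the factor in front of the sum and
      \<open>l ^ m\<close> multiplied into the sum.\<close>
  have "((\<lambda>l. (1 + 1 / l) * (geom_sum (D - 1) l / l ^ (D - 1)) * (\<Sum>w\<in>root_path v. l ^ m * elasticity (d_out G r w) l))
      \<longlongrightarrow> (1 + 0) * 1 * (\<Sum>w\<in>root_path v. if d_out G r w = m then real m else 0)) at_top"
    using m d_out_min_le[OF v]
    by (intro tendsto_mult lin geom_sum_at_top tendsto_sum elasticity_scaled_at_top) (auto simp: m_def)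
  then have "((\<lambda>l. inverse ((1 + 1 / l) * (geom_sum (D - 1) l / l ^ (D - 1)) * (\<Sum>w\<in>root_path v. l ^ m * elasticity (d_out G r w) l)))
      \<longlongrightarrow> inverse (real (card (J_set G r v)) * real m)) at_top"
    using J J0 m by (intro tendsto_inverse) auto
  moreover have "\<forall>\<^sub>F l in at_top.
      inverse ((1 + 1 / l) * (geom_sum (D - 1) l / l ^ (D - 1)) * (\<Sum>w\<in>root_path v. l ^ m * elasticity (d_out G r w) l))
      = l powi (int D - int m) * Stake G r 1 l v"
    using eventually_gt_at_top[of 0]
  proof eventually_elim
    case (elim l)
    have prefactor: "(1 + 1 / l) * (geom_sum (D - 1) l / l ^ (D - 1))
        = (l + 1) * geom_sum (D - 1) l / l ^ D"
      using elim D(1) by (cases D) (auto simp: field_simps)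
    have "l powi (int D - int m) = l ^ D / l ^ m"
      using elim by (simp add: power_int_diff)
    then show ?case
      unfolding prefactor Stake_eq[OF v elim] D_def[symmetric] sum_distrib_left[symmetric]
      by (simp add: divide_inverse mult_ac)
  qed
  ultimately show ?thesis unfolding D_def m_def by (rule Lim_transform_eventually)
qed

end

theorem proposition1p19:
  fixes G :: "('a, 'b) pre_digraph" and r v :: 'a
  assumes "root_reward_tree G r"
    and "v \<in> inner_verts G"
  shows "((\<lambda>l. Stake G r 1 l v) \<longlongrightarrow> inverse (real (d_in G r v))) (at_right 0) \<and>
    Stake G r 1 1 v = inverse (real (d_out G r v)) * inverse (real (d_in G r v)) \<and>
    ((\<lambda>l. l powi (int (d_out G r v) - int (d_out_min G r v)) * Stake G r 1 l v)
       \<longlongrightarrow> inverse (real (card (J_set G r v)) * real (d_out_min G r v))) at_top"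
proof -
  interpret root_reward_tree G r by fact
  show ?thesis using Stake_tendsto_at_0 Stake_at_1 Stake_scaled_at_top assms(2) by blast
qed

end
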